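(* Let $(D_\lambda)_{\lambda\in\Lambda}$ be a family of integral domains satisfying property (+), none of which is a field, and let $R=\prod_{\lambda\in\Lambda}D_\lambda$. Then the maximal ideals of $R$ are exactly the ideals of the form $(\mathcal{U})$, where $\mathcal{U}$ is an ultrafilter in the Boolean algebra $\mathcal{B}=\prod_{\lambda\in\Lambda}\mathcal{P}(\max(D_\lambda))$ containing an element of the form $(\mathscr{V}(a_\lambda))_{\lambda\in\Lambda}$ with $a_\lambda\in D_\lambda$ and $a_\lambda\neq 0$ for all $\lambda\in\Lambda$.
   Context: Rings are commutative with identity. For a ring $D$, $\max(D)$ is the set of maximal ideals of $D$ and, for $a\in D$, $\mathscr{V}(a)=\{M\in\max(D)\mid a\in M\}$. A ring $D$ satisfies property (+) if for all $r\in D$ and $a\in D\setminus\{0\}$ there exists $d\in D$ such that $d$ is in every maximal ideal of $D$ that contains $a$ but not $r$, and $d$ is in no maximal ideal of $D$ that contains $r$. $\mathcal{B}$ carries the componentwise Boolean operations (least element $(\emptyset)_\lambda$; $Y\le Z$ iff $Y_\lambda\subseteq Z_\lambda$ for all $\lambda$); an ultrafilter in $\mathcal{B}$ is a maximal proper filter. For $a=(a_\lambda)\in R$, $S(a)=(\mathscr{V}(a_\lambda))_{\lambda\in\Lambda}\in\mathcal{B}$, and $(\mathcal{U})=\{a\in R\mid S(a)\in\mathcal{U}\}$. *)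

theory Defs
  imports "HOL-Algebra.Algebra"
begin

section \<open>Products of rings\<close>

text \<open>Ring analogue of \<^const>\<open>product_group\<close>: elements are the extensional choice functions on
  the index set. The factors share one carrier type but are otherwise arbitrary.\<close>

definition product_ring :: "'i set \<Rightarrow> ('i \<Rightarrow> ('a, 'm) ring_scheme) \<Rightarrow> ('i \<Rightarrow> 'a) ring" where
  "product_ring I D =
    \<lparr>carrier = (\<Pi>\<^sub>E i\<in>I. carrier (D i)),
     monoid.mult = (\<lambda>x y. \<lambda>i\<in>I. x i \<otimes>\<^bsub>D i\<^esub> y i),
     monoid.one = (\<lambda>i\<in>I. \<one>\<^bsub>D i\<^esub>),
     ring.zero = (\<lambda>i\<in>I. \<zero>\<^bsub>D i\<^esub>),
     ring.add = (\<lambda>x y. \<lambda>i\<in>I. x i \<oplus>\<^bsub>D i\<^esub> y i)\<rparr>"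

lemma product_ring_simps [simp]:
  "carrier (product_ring I D) = (\<Pi>\<^sub>E i\<in>I. carrier (D i))"
  "x \<otimes>\<^bsub>product_ring I D\<^esub> y = (\<lambda>i\<in>I. x i \<otimes>\<^bsub>D i\<^esub> y i)"
  "\<one>\<^bsub>product_ring I D\<^esub> = (\<lambda>i\<in>I. \<one>\<^bsub>D i\<^esub>)"
  "\<zero>\<^bsub>product_ring I D\<^esub> = (\<lambda>i\<in>I. \<zero>\<^bsub>D i\<^esub>)"
  "x \<oplus>\<^bsub>product_ring I D\<^esub> y = (\<lambda>i\<in>I. x i \<oplus>\<^bsub>D i\<^esub> y i)"
  by (simp_all add: product_ring_def)

lemma product_ring_cring:
  assumes "\<And>i. i \<in> I \<Longrightarrow> cring (D i)"
  shows "cring (product_ring I D)"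
proof -
  have ring: "ring (D i)" if "i \<in> I" for i
    using assms[OF that] by (rule cring.axioms)
  note simprules = ring.ring_simprules[OF ring]
  have "abelian_group (product_ring I D)"
  proof (rule abelian_groupI)
    fix x y assume "x \<in> carrier (product_ring I D)" "y \<in> carrier (product_ring I D)"
    then show "x \<oplus>\<^bsub>product_ring I D\<^esub> y = y \<oplus>\<^bsub>product_ring I D\<^esub> x"
      by (auto simp: PiE_iff intro!: restrict_ext simprules(10))
  next
    fix x assume x: "x \<in> carrier (product_ring I D)"
    show "\<zero>\<^bsub>product_ring I D\<^esub> \<oplus>\<^bsub>product_ring I D\<^esub> x = x"
      using x by (auto simp: PiE_iff simprules(8) fun_eq_iff extensional_def)
    show "\<exists>y\<in>carrier (product_ring I D).
        y \<oplus>\<^bsub>product_ring I D\<^esub> x = \<zero>\<^bsub>product_ring I D\<^esub>"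
      using x by (intro bexI[of _ "\<lambda>i\<in>I. \<ominus>\<^bsub>D i\<^esub> x i"])
        (auto simp: PiE_iff simprules(3,9) intro!: restrict_ext)
  qed (auto simp: PiE_iff simprules(1,2,7) intro!: restrict_ext)
  moreover have "Group.comm_monoid (product_ring I D)"
  proof (rule comm_monoidI)
    fix x assume "x \<in> carrier (product_ring I D)"
    then show "\<one>\<^bsub>product_ring I D\<^esub> \<otimes>\<^bsub>product_ring I D\<^esub> x = x"
      by (auto simp: PiE_iff simprules(12) fun_eq_iff extensional_def)
  next
    fix x y assume "x \<in> carrier (product_ring I D)" "y \<in> carrier (product_ring I D)"
    then show "x \<otimes>\<^bsub>product_ring I D\<^esub> y = y \<otimes>\<^bsub>product_ring I D\<^esub> x"
      by (auto simp: PiE_iff intro!: restrict_ext cring.cring_simprules(14)[OF assms])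
  qed (auto simp: PiE_iff simprules(5,6,11) intro!: restrict_ext)
  ultimately show ?thesis
    by (rule cringI) (auto simp: PiE_iff simprules(1,5,13) intro!: restrict_ext)
qed

section \<open>Maximal ideals and property (+)\<close>

definition max_ideals :: "('a, 'm) ring_scheme \<Rightarrow> 'a set set" where
  "max_ideals D = {M. maximalideal M D}"

definition max_ideals_containing :: "('a, 'm) ring_scheme \<Rightarrow> 'a \<Rightarrow> 'a set set" where
  "max_ideals_containing D a = {M \<in> max_ideals D. a \<in> M}"

definition property_plus :: "('a, 'm) ring_scheme \<Rightarrow> bool" where
  "property_plus D \<longleftrightarrow>
    (\<forall>r\<in>carrier D. \<forall>a\<in>carrier D - {\<zero>\<^bsub>D\<^esub>}. \<exists>d\<in>carrier D.
       (\<forall>M\<in>max_ideals D. a \<in> M \<and> r \<notin> M \<longrightarrow> d \<in> M) \<and>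
       (\<forall>M\<in>max_ideals D. r \<in> M \<longrightarrow> d \<notin> M))"

section \<open>Products of power sets, and ultrafilters in them\<close>

definition product_powerset :: "'i set \<Rightarrow> ('i \<Rightarrow> 'b set) \<Rightarrow> ('i \<Rightarrow> 'b set) gorder" where
  "product_powerset I A =
    \<lparr>carrier = (\<Pi>\<^sub>E i\<in>I. Pow (A i)),
     eq = (=),
     le = (\<lambda>Y Z. \<forall>i\<in>I. Y i \<subseteq> Z i)\<rparr>"

lemma product_powerset_simps [simp]:
  "carrier (product_powerset I A) = (\<Pi>\<^sub>E i\<in>I. Pow (A i))"
  "Y .=\<^bsub>product_powerset I A\<^esub> Z \<longleftrightarrow> Y = Z"
  "Y \<sqsubseteq>\<^bsub>product_powerset I A\<^esub> Z \<longleftrightarrow> (\<forall>i\<in>I. Y i \<subseteq> Z i)"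
  by (simp_all add: product_powerset_def)

lemma product_powerset_partial_order: "partial_order (product_powerset I A)"
proof
  fix Y Z
  assume "Y \<in> carrier (product_powerset I A)" "Z \<in> carrier (product_powerset I A)"
    "Y \<sqsubseteq>\<^bsub>product_powerset I A\<^esub> Z" "Z \<sqsubseteq>\<^bsub>product_powerset I A\<^esub> Y"
  then show "Y .=\<^bsub>product_powerset I A\<^esub> Z"
    by (simp, intro PiE_ext[of Y I _ Z]) auto
qed (auto simp: product_powerset_def)

lemma product_powerset_greatest:
  assumes "Y \<in> carrier (product_powerset I A)" "Z \<in> carrier (product_powerset I A)"
  shows "greatest (product_powerset I A) (\<lambda>i\<in>I. Y i \<inter> Z i)
           (Lower (product_powerset I A) {Y, Z})"
  using assms by (intro greatest_LowerI) (auto simp: Lower_def PiE_iff)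

lemma product_powerset_least:
  assumes "Y \<in> carrier (product_powerset I A)" "Z \<in> carrier (product_powerset I A)"
  shows "least (product_powerset I A) (\<lambda>i\<in>I. Y i \<union> Z i)
           (Upper (product_powerset I A) {Y, Z})"
  using assms by (intro least_UpperI) (auto simp: Upper_def PiE_iff)

lemma product_powerset_lattice: "lattice (product_powerset I A)"
proof -
  interpret partial_order "product_powerset I A"
    by (rule product_powerset_partial_order)
  show ?thesis
    by unfold_locales (blast intro: product_powerset_least product_powerset_greatest)+
qed

lemma product_powerset_meet:
  assumes "Y \<in> carrier (product_powerset I A)" "Z \<in> carrier (product_powerset I A)"
  shows "Y \<sqinter>\<^bsub>product_powerset I A\<^esub> Z = (\<lambda>i\<in>I. Y i \<inter> Z i)"
proof -
  interpret lattice "product_powerset I A"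
    by (rule product_powerset_lattice)
  show ?thesis
    unfolding meet_def
    using greatest_unique[OF inf_of_two_greatest product_powerset_greatest] assms by blast
qed

definition lattice_filter :: "('b, 'c) gorder_scheme \<Rightarrow> 'b set \<Rightarrow> bool" where
  "lattice_filter L F \<longleftrightarrow>
     F \<subseteq> carrier L \<and> F \<noteq> {} \<and>
     (\<forall>x\<in>F. \<forall>y\<in>F. x \<sqinter>\<^bsub>L\<^esub> y \<in> F) \<and>
     (\<forall>x\<in>F. \<forall>y\<in>carrier L. x \<sqsubseteq>\<^bsub>L\<^esub> y \<longrightarrow> y \<in> F)"

definition proper_filter :: "('b, 'c) gorder_scheme \<Rightarrow> 'b set \<Rightarrow> bool" where
  "proper_filter L F \<longleftrightarrow> lattice_filter L F \<and> F \<noteq> carrier L"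

definition ultrafilter :: "('b, 'c) gorder_scheme \<Rightarrow> 'b set \<Rightarrow> bool" where
  "ultrafilter L U \<longleftrightarrow>
     proper_filter L U \<and> (\<forall>F. proper_filter L F \<and> U \<subseteq> F \<longrightarrow> F = U)"

lemma proper_filter_product_powerset_iff:
  "proper_filter (product_powerset I A) F \<longleftrightarrow>
     lattice_filter (product_powerset I A) F \<and> (\<lambda>i\<in>I. {}) \<notin> F"
proof -
  let ?B = "product_powerset I A" and ?bot = "\<lambda>i\<in>I. {}"
  have "?bot \<in> carrier ?B"
    by auto
  moreover have "carrier ?B \<subseteq> F" if "lattice_filter ?B F" "?bot \<in> F"
  proof
    fix Y assume "Y \<in> carrier ?B"
    moreover have "?bot \<sqsubseteq>\<^bsub>?B\<^esub> Y"
      by simp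
    ultimately show "Y \<in> F"
      using that unfolding lattice_filter_def by blast
  qed
  moreover have "F \<subseteq> carrier ?B" if "lattice_filter ?B F"
    using that unfolding lattice_filter_def by blast
  ultimately show ?thesis
    unfolding proper_filter_def by blast
qed

section \<open>The ideals determined by filters\<close>

text \<open>In the usual notation, the next three constants are $\mathcal{B}$, $S(a)$ and $(\mathcal{U})$;
  the value \<^term>\<open>max_ideals_containing R a\<close> is $\mathscr{V}(a)$.\<close>

definition max_spec_algebra ::
    "'i set \<Rightarrow> ('i \<Rightarrow> ('a, 'm) ring_scheme) \<Rightarrow> ('i \<Rightarrow> 'a set set) gorder" where
  "max_spec_algebra I D = product_powerset I (\<lambda>i. max_ideals (D i))"

definition max_support ::
    "'i set \<Rightarrow> ('i \<Rightarrow> ('a, 'm) ring_scheme) \<Rightarrow> ('i \<Rightarrow> 'a) \<Rightarrow> 'i \<Rightarrow> 'a set set" where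
  "max_support I D a = (\<lambda>i\<in>I. max_ideals_containing (D i) (a i))"

definition filter_ideal ::
    "'i set \<Rightarrow> ('i \<Rightarrow> ('a, 'm) ring_scheme) \<Rightarrow> ('i \<Rightarrow> 'a set set) set \<Rightarrow> ('i \<Rightarrow> 'a) set" where
  "filter_ideal I D U = {a \<in> carrier (product_ring I D). max_support I D a \<in> U}"

end

theory Submission
  imports Defs
begin

text \<open>Given \<open>r\<close> and \<open>a\<close> with \<open>a\<close> nonzero in every coordinate, property (+) yields \<open>d\<close> with
  \<open>S(a) - S(r) \<le> S(d)\<close> and \<open>S(d)\<close> disjoint from \<open>S(r)\<close>; by Krull's theorem in the factors, elements
  with disjoint supports generate the unit ideal of \<open>R\<close>.

  If \<open>S(a) \<in> U\<close> and \<open>r \<notin> (U)\<close>, then \<open>S(a) - S(r) \<in> U\<close>, so \<open>d \<in> (U)\<close> is comaximal with \<open>r\<close>: the ideal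
  \<open>(U)\<close> is maximal. Conversely, a maximal ideal \<open>M\<close> contains some \<open>a\<close> without zero coordinates: for
  \<open>b\<close> with nonzero nonunit coordinates, either \<open>b \<in> M\<close> or \<open>1 - x b \<in> M\<close> for some \<open>x\<close>. If
  \<open>b, c \<in> M\<close> and \<open>d\<close> belongs to \<open>r = b\<close>, then \<open>e = b + d c\<close> satisfies
  \<open>S(a) \<inter> S(e) \<le> S(b) \<inter> S(c)\<close>, so the sets \<open>S(a) \<inter> S(b)\<close>, \<open>b \<in> M\<close>, form a filter base. Any ultrafilter
  \<open>U\<close> refining it has \<open>M \<subseteq> (U)\<close>, hence \<open>M = (U)\<close>.\<close>

section \<open>Maximal ideals of commutative rings\<close>

lemma max_ideals_containingD:
  assumes "M \<in> max_ideals_containing R a"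
  shows "maximalideal M R" "a \<in> M"
  using assms by (auto simp: max_ideals_containing_def max_ideals_def)

text \<open>Krull's theorem, by Zorn's lemma. Properness is expressed as
  \<open>\<one> \<notin> J\<close>, a condition that visibly survives unions of chains.\<close>

lemma (in ring) exists_max_ideal_above:
  assumes "ideal I R" "I \<noteq> carrier R"
  shows "\<exists>M\<in>max_ideals R. I \<subseteq> M"
proof -
  let ?A = "{J. ideal J R \<and> I \<subseteq> J \<and> \<one> \<notin> J}"
  have I: "I \<in> ?A"
    using assms ideal.one_imp_carrier by blast
  have "\<exists>M\<in>?A. \<forall>W\<in>?A. M \<subseteq> W \<longrightarrow> W = M"
  proof (rule subset_Zorn_nonempty)
    show "?A \<noteq> {}"
      using I by blast
    fix C
    assume C: "C \<noteq> {}" "subset.chain ?A C"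
    then have "subset.chain {J. ideal J R} C"
      by (auto simp: subset_chain_def)
    from chain_Union_is_ideal[OF this] C(1) have "ideal (\<Union>C) R"
      by simp
    moreover have C_mem: "I \<subseteq> J" "\<one> \<notin> J" if "J \<in> C" for J
      using C(2) that by (auto simp: subset_chain_def)
    moreover have "I \<subseteq> \<Union>C"
    proof -
      obtain J where "J \<in> C"
        using C(1) by blast
      from C_mem(1)[OF this] Union_upper[OF this] show ?thesis
        by (rule order_trans)
    qed
    ultimately show "\<Union>C \<in> ?A"
      by simp
  qed
  then obtain M where M: "M \<in> ?A" and max: "\<forall>W\<in>?A. M \<subseteq> W \<longrightarrow> W = M"
    by (rule bexE)
  have "maximalideal M R"
  proof (rule maximalidealI)
    fix J
    assume J: "ideal J R" "M \<subseteq> J" "J \<subseteq> carrier R"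
    show "J = M \<or> J = carrier R"
    proof (cases "\<one> \<in> J")
      case True
      then show ?thesis
        using ideal.one_imp_carrier[OF J(1)] by blast
    next
      case False
      then have "J \<in> ?A"
        using J(1,2) M by auto
      with max have "M \<subseteq> J \<longrightarrow> J = M" ..
      then show ?thesis
        using J(2) by blast
    qed
  qed (use M one_closed in auto)
  then show ?thesis
    using M by (auto simp: max_ideals_def)
qed

text \<open>This is the sum of \<open>I\<close> and the principal ideal of \<open>b\<close>. It is
  written out elementwise so that membership of \<open>\<one>\<close> reads directly as an
  equation.\<close>

lemma (in cring) ideal_add_multiples:
  assumes "ideal I R" "b \<in> carrier R"
  shows "ideal {m \<oplus> x \<otimes> b | m x. m \<in> I \<and> x \<in> carrier R} R"
proof -
  have "{m \<oplus> x \<otimes> b | m x. m \<in> I \<and> x \<in> carrier R} = I <+> PIdl b"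
    by (auto simp: set_add_def' cgenideal_def)
  then show ?thesis
    using add_ideals[OF assms(1) cgenideal_ideal[OF assms(2)]] by simp
qed

lemma (in cring) maximalideal_comaximal:
  assumes "maximalideal M R" "b \<in> carrier R" "b \<notin> M"
  obtains m x where "m \<in> M" "x \<in> carrier R" "m \<oplus> x \<otimes> b = \<one>"
proof -
  interpret M: maximalideal M R by fact
  let ?J = "{m \<oplus> x \<otimes> b | m x. m \<in> M \<and> x \<in> carrier R}"
  have J: "ideal ?J R"
    using ideal_add_multiples[OF M.ideal_axioms assms(2)] .
  have "m \<in> ?J" if "m \<in> M" for m
  proof -
    have "m = m \<oplus> \<zero> \<otimes> b"
      using M.Icarr[OF that] assms(2) by simp
    then show ?thesis
      using that by blast
  qed
  moreover have "b = \<zero> \<oplus> \<one> \<otimes> b"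
    using assms(2) by simp
  then have "b \<in> ?J"
    using M.zero_closed by blast
  moreover have "?J \<subseteq> carrier R"
    using ideal.Icarr[OF J] by blast
  ultimately have "?J = carrier R"
    using M.I_maximal[OF J] assms(3) by blast
  then have "\<one> \<in> ?J"
    by simp
  then show ?thesis
    using that by force
qed

text \<open>If the ideal generated by \<open>b\<close> and \<open>c\<close> were proper, Krull's
  theorem would put both into one maximal ideal. The resulting equation, unlike the disjointness,
  can be carried over to the product coordinate by coordinate.\<close>

lemma (in cring) disjoint_max_ideals_comaximal:
  assumes "b \<in> carrier R" "c \<in> carrier R"
    and disj: "max_ideals_containing R b \<inter> max_ideals_containing R c = {}"
  obtains x y where "x \<in> carrier R" "y \<in> carrier R" "x \<otimes> b \<oplus> y \<otimes> c = \<one>"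
proof -
  let ?J = "{m \<oplus> y \<otimes> c | m y. m \<in> PIdl b \<and> y \<in> carrier R}"
  have J: "ideal ?J R"
    using ideal_add_multiples[OF cgenideal_ideal[OF assms(1)] assms(2)] .
  have b: "b \<in> PIdl b"
    using cgenideal_self[OF assms(1)] .
  have "b = b \<oplus> \<zero> \<otimes> c"
    using assms by simp
  then have bJ: "b \<in> ?J"
    using b by blast
  have "\<zero> = \<zero> \<otimes> b"
    using assms by simp
  then have "\<zero> \<in> PIdl b"
    unfolding cgenideal_def by blast
  moreover have "c = \<zero> \<oplus> \<one> \<otimes> c"
    using assms by simp
  ultimately have cJ: "c \<in> ?J"
    by blast
  have "?J = carrier R"
  proof (rule ccontr)
    assume "?J \<noteq> carrier R"
    from exists_max_ideal_above[OF J this] obtain M where "M \<in> max_ideals R" "?J \<subseteq> M"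
      by blast
    then have "M \<in> max_ideals_containing R b \<inter> max_ideals_containing R c"
      using bJ cJ by (auto simp only: max_ideals_containing_def)
    then show False
      using disj by blast
  qed
  then have "\<one> \<in> ?J"
    by simp
  then show ?thesis
    using that unfolding cgenideal_def by force
qed

section \<open>The sets V(a) under the ring operations\<close>

lemma max_ideals_containing_zero:
  "max_ideals_containing R \<zero>\<^bsub>R\<^esub> = max_ideals R"
proof -
  have "\<zero>\<^bsub>R\<^esub> \<in> M" if "M \<in> max_ideals R" for M
  proof -
    interpret maximalideal M R
      using that by (simp add: max_ideals_def)
    show ?thesis
      by simp
  qed
  then show ?thesis
    by (auto simp: max_ideals_containing_def)
qed

lemma max_ideals_containing_one: "max_ideals_containing R \<one>\<^bsub>R\<^esub> = {}"
proof -
  have False if "M \<in> max_ideals_containing R \<one>\<^bsub>R\<^esub>" for M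
  proof -
    interpret maximalideal M R
      using max_ideals_containingD(1)[OF that] .
    show False
      using one_imp_carrier[OF max_ideals_containingD(2)[OF that]] I_notcarr by simp
  qed
  then show ?thesis
    by blast
qed

lemma max_ideals_containing_add:
  "max_ideals_containing R b \<inter> max_ideals_containing R c \<subseteq> max_ideals_containing R (b \<oplus>\<^bsub>R\<^esub> c)"
proof
  fix M
  assume M: "M \<in> max_ideals_containing R b \<inter> max_ideals_containing R c"
  interpret maximalideal M R
    using M by (simp add: max_ideals_containing_def max_ideals_def)
  show "M \<in> max_ideals_containing R (b \<oplus>\<^bsub>R\<^esub> c)"
    using M by (auto simp: max_ideals_containing_def)
qed

lemma max_ideals_containing_mult:
  assumes "x \<in> carrier R"
  shows "max_ideals_containing R b \<subseteq> max_ideals_containing R (x \<otimes>\<^bsub>R\<^esub> b)"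
proof
  fix M
  assume M: "M \<in> max_ideals_containing R b"
  interpret maximalideal M R
    using M by (simp add: max_ideals_containing_def max_ideals_def)
  show "M \<in> max_ideals_containing R (x \<otimes>\<^bsub>R\<^esub> b)"
    using M assms I_l_closed by (auto simp: max_ideals_containing_def)
qed

text \<open>Here \<open>d\<close> is what property (+) provides for \<open>b\<close> and
  \<open>a\<close>. In a maximal ideal with \<open>a\<close> and
  \<open>b \<oplus> d \<otimes> c\<close>, absence of \<open>b\<close> would force \<open>d\<close>
  in, and then \<open>b\<close> as a difference. So \<open>b\<close> and
  \<open>d \<otimes> c\<close> are in, \<open>d\<close> is out by disjointness, and primeness gives
  \<open>c\<close>. Within V(a), one element thus does the work of the pair.\<close>

lemma (in cring) max_ideals_containing_combination:
  assumes carr: "b \<in> carrier R" "c \<in> carrier R" "d \<in> carrier R"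
    and sub: "max_ideals_containing R a - max_ideals_containing R b \<subseteq> max_ideals_containing R d"
    and disj: "max_ideals_containing R b \<inter> max_ideals_containing R d = {}"
  shows "max_ideals_containing R a \<inter> max_ideals_containing R (b \<oplus> d \<otimes> c)
    \<subseteq> max_ideals_containing R b \<inter> max_ideals_containing R c"
proof
  fix M
  assume M: "M \<in> max_ideals_containing R a \<inter> max_ideals_containing R (b \<oplus> d \<otimes> c)"
  then have max: "maximalideal M R" and e: "b \<oplus> d \<otimes> c \<in> M"
    by (simp_all add: max_ideals_containing_def max_ideals_def)
  interpret M: maximalideal M R by fact
  interpret P: primeideal M R
    using maximalideal_prime[OF max] .
  have V: "M \<in> max_ideals_containing R x \<longleftrightarrow> x \<in> M" for x
    using max by (auto simp: max_ideals_containing_def max_ideals_def)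
  have b: "b \<in> M"
  proof (rule ccontr)
    assume b: "b \<notin> M"
    then have "d \<in> M"
      using M sub V by blast
    then have "d \<otimes> c \<in> M"
      using carr M.I_r_closed by blast
    then have "(b \<oplus> d \<otimes> c) \<ominus> d \<otimes> c \<in> M"
      using e by (simp add: a_minus_def)
    moreover have "(b \<oplus> d \<otimes> c) \<ominus> d \<otimes> c = b"
      using carr by algebra
    ultimately show False
      using b by simp
  qed
  have "(b \<oplus> d \<otimes> c) \<ominus> b \<in> M"
    using e b by (simp add: a_minus_def)
  moreover have "(b \<oplus> d \<otimes> c) \<ominus> b = d \<otimes> c"
    using carr by algebra
  ultimately have "d \<otimes> c \<in> M"
    by simp
  moreover have "d \<notin> M"
    using b disj V by blast
  ultimately have "c \<in> M"
    using P.I_prime carr by blast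
  then show "M \<in> max_ideals_containing R b \<inter> max_ideals_containing R c"
    using b V by blast
qed

section \<open>Ultrafilters in products of power sets\<close>

text \<open>Together with its converse below, this replaces the abstract meet and order by
  coordinatewise intersection and inclusion in all later filter arguments.\<close>

lemma lattice_filter_product_powersetI:
  assumes "F \<subseteq> (\<Pi>\<^sub>E i\<in>I. Pow (A i))" "F \<noteq> {}"
    and "\<And>Y Z. Y \<in> F \<Longrightarrow> Z \<in> F \<Longrightarrow> (\<lambda>i\<in>I. Y i \<inter> Z i) \<in> F"
    and "\<And>Y Z. Y \<in> F \<Longrightarrow> Z \<in> (\<Pi>\<^sub>E i\<in>I. Pow (A i)) \<Longrightarrow> (\<And>i. i \<in> I \<Longrightarrow> Y i \<subseteq> Z i) \<Longrightarrow> Z \<in> F"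
  shows "lattice_filter (product_powerset I A) F"
  unfolding lattice_filter_def
proof (intro conjI ballI impI)
  fix Y Z
  assume YZ: "Y \<in> F" "Z \<in> F"
  then have "Y \<in> carrier (product_powerset I A)" "Z \<in> carrier (product_powerset I A)"
    using assms(1) by auto
  then show "Y \<sqinter>\<^bsub>product_powerset I A\<^esub> Z \<in> F"
    using assms(3)[OF YZ] by (simp only: product_powerset_meet)
next
  fix Y Z
  assume "Y \<in> F" "Z \<in> carrier (product_powerset I A)" "Y \<sqsubseteq>\<^bsub>product_powerset I A\<^esub> Z"
  then show "Z \<in> F"
    using assms(4)[of Y Z] by simp
qed (use assms in auto)

lemma lattice_filter_product_powersetD:
  assumes "lattice_filter (product_powerset I A) F"
  shows "F \<subseteq> (\<Pi>\<^sub>E i\<in>I. Pow (A i))" "F \<noteq> {}"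
    and "\<And>Y Z. Y \<in> F \<Longrightarrow> Z \<in> F \<Longrightarrow> (\<lambda>i\<in>I. Y i \<inter> Z i) \<in> F"
    and "\<And>Y Z. Y \<in> F \<Longrightarrow> Z \<in> (\<Pi>\<^sub>E i\<in>I. Pow (A i)) \<Longrightarrow> (\<And>i. i \<in> I \<Longrightarrow> Y i \<subseteq> Z i) \<Longrightarrow> Z \<in> F"
proof -
  show sub: "F \<subseteq> (\<Pi>\<^sub>E i\<in>I. Pow (A i))" and "F \<noteq> {}"
    using assms unfolding lattice_filter_def by auto
  show "(\<lambda>i\<in>I. Y i \<inter> Z i) \<in> F" if "Y \<in> F" "Z \<in> F" for Y Z
  proof -
    have "Y \<in> carrier (product_powerset I A)" "Z \<in> carrier (product_powerset I A)"
      using that sub by auto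
    from product_powerset_meet[OF this, symmetric] show ?thesis
      using assms that unfolding lattice_filter_def by metis
  qed
  show "Z \<in> F" if "Y \<in> F" "Z \<in> (\<Pi>\<^sub>E i\<in>I. Pow (A i))" "\<And>i. i \<in> I \<Longrightarrow> Y i \<subseteq> Z i" for Y Z
  proof -
    have "Z \<in> carrier (product_powerset I A)" "Y \<sqsubseteq>\<^bsub>product_powerset I A\<^esub> Z"
      using that(2,3) by simp_all
    then show ?thesis
      using assms that(1) unfolding lattice_filter_def by blast
  qed
qed

lemma ultrafilter_product_powersetD:
  assumes "ultrafilter (product_powerset I A) U"
  shows "lattice_filter (product_powerset I A) U" "(\<lambda>i\<in>I. {}) \<notin> U"
  using assms unfolding ultrafilter_def proper_filter_product_powerset_iff by auto

text \<open>Zorn's lemma again: being proper amounts to omitting the least element, which passes to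
  unions of chains.\<close>

lemma exists_ultrafilter_above:
  assumes "proper_filter (product_powerset I A) F"
  shows "\<exists>U. ultrafilter (product_powerset I A) U \<and> F \<subseteq> U"
proof -
  let ?B = "product_powerset I A"
  let ?\<F> = "{G. proper_filter ?B G \<and> F \<subseteq> G}"
  have "\<exists>U\<in>?\<F>. \<forall>W\<in>?\<F>. U \<subseteq> W \<longrightarrow> W = U"
  proof (rule subset_Zorn_nonempty)
    show "?\<F> \<noteq> {}"
      using assms by blast
    fix C
    assume C: "C \<noteq> {}" "subset.chain ?\<F> C"
    have mem: "lattice_filter ?B G" "(\<lambda>i\<in>I. {}) \<notin> G" "F \<subseteq> G" if "G \<in> C" for G
      using that C(2) by (auto simp: subset_chain_def proper_filter_product_powerset_iff)
    have "lattice_filter ?B (\<Union>C)"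
    proof (rule lattice_filter_product_powersetI)
      show "\<Union>C \<subseteq> (\<Pi>\<^sub>E i\<in>I. Pow (A i))"
        by (rule Union_least) (rule lattice_filter_product_powersetD(1)[OF mem(1)])
      obtain G where "G \<in> C"
        using C(1) by blast
      then show "\<Union>C \<noteq> {}"
        using lattice_filter_product_powersetD(2)[OF mem(1)] by blast
      fix Y Z
      assume Y: "Y \<in> \<Union>C"
      {
        assume "Z \<in> \<Union>C"
        with Y obtain G where G: "G \<in> C" "Y \<in> G" "Z \<in> G"
          using C(2) unfolding subset_chain_def by blast
        show "(\<lambda>i\<in>I. Y i \<inter> Z i) \<in> \<Union>C"
          using lattice_filter_product_powersetD(3)[OF mem(1)[OF G(1)] G(2,3)] G(1)
          by (rule UnionI[rotated])
      next
        assume Z: "Z \<in> (\<Pi>\<^sub>E i\<in>I. Pow (A i))" "\<And>i. i \<in> I \<Longrightarrow> Y i \<subseteq> Z i"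
        obtain G where G: "G \<in> C" "Y \<in> G"
          using Y by blast
        show "Z \<in> \<Union>C"
          using lattice_filter_product_powersetD(4)[OF mem(1)[OF G(1)] G(2) Z] G(1)
          by (rule UnionI[rotated])
      }
    qed
    moreover have "(\<lambda>i\<in>I. {}) \<notin> \<Union>C"
      using mem(2) by blast
    moreover have "F \<subseteq> \<Union>C"
    proof -
      obtain G where "G \<in> C"
        using C(1) by blast
      from mem(3)[OF this] Union_upper[OF this] show ?thesis
        by (rule order_trans)
    qed
    ultimately show "\<Union>C \<in> ?\<F>"
      by (simp add: proper_filter_product_powerset_iff)
  qed
  then obtain U where "U \<in> ?\<F>" "\<forall>G\<in>?\<F>. U \<subseteq> G \<longrightarrow> G = U"
    by (rule bexE)
  then have "ultrafilter ?B U" "F \<subseteq> U"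
    by (auto simp: ultrafilter_def)
  then show ?thesis
    by blast
qed

text \<open>This is the filter generated by \<open>F\<close> and \<open>Y\<close>, the competitor
  against which maximality of an ultrafilter is tested.\<close>

lemma lattice_filter_adjoin:
  assumes "lattice_filter (product_powerset I A) F" "Y \<in> (\<Pi>\<^sub>E i\<in>I. Pow (A i))"
  shows "lattice_filter (product_powerset I A)
    {Z \<in> (\<Pi>\<^sub>E i\<in>I. Pow (A i)). \<exists>W\<in>F. \<forall>i\<in>I. W i \<inter> Y i \<subseteq> Z i}" (is "lattice_filter _ ?G")
proof (rule lattice_filter_product_powersetI)
  note F = lattice_filter_product_powersetD[OF assms(1)]
  show "?G \<subseteq> (\<Pi>\<^sub>E i\<in>I. Pow (A i))"
    by blast
  show "?G \<noteq> {}"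
    using F(2) assms(2) by blast
  fix Z Z'
  assume Z: "Z \<in> ?G"
  {
    assume "Z' \<in> ?G"
    with Z obtain W W' where W: "W \<in> F" "W' \<in> F"
      "\<forall>i\<in>I. W i \<inter> Y i \<subseteq> Z i" "\<forall>i\<in>I. W' i \<inter> Y i \<subseteq> Z' i"
      by blast
    then have "\<forall>i\<in>I. (\<lambda>i\<in>I. W i \<inter> W' i) i \<inter> Y i \<subseteq> (\<lambda>i\<in>I. Z i \<inter> Z' i) i"
      by auto
    moreover have "(\<lambda>i\<in>I. Z i \<inter> Z' i) \<in> (\<Pi>\<^sub>E i\<in>I. Pow (A i))"
      using Z by (auto simp: PiE_iff)
    ultimately show "(\<lambda>i\<in>I. Z i \<inter> Z' i) \<in> ?G"
      using F(3)[OF W(1,2)] by blast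
  next
    assume Z': "Z' \<in> (\<Pi>\<^sub>E i\<in>I. Pow (A i))" "\<And>i. i \<in> I \<Longrightarrow> Z i \<subseteq> Z' i"
    from Z obtain W where W: "W \<in> F" "\<forall>i\<in>I. W i \<inter> Y i \<subseteq> Z i"
      by blast
    have "\<forall>i\<in>I. W i \<inter> Y i \<subseteq> Z' i"
      using W(2) Z'(2) by (meson order_trans)
    then show "Z' \<in> ?G"
      using W(1) Z'(1) by blast
  }
qed

text \<open>Adjoining \<open>Y\<close> to \<open>U\<close> gives a strictly larger filter, which
  must be improper and so contains the least element. Hence some \<open>W\<close> in
  \<open>U\<close> is disjoint from \<open>Y\<close>, that is, lies below its complement.\<close>

lemma ultrafilter_compl:
  assumes U: "ultrafilter (product_powerset I A) U"
    and Y: "Y \<in> (\<Pi>\<^sub>E i\<in>I. Pow (A i))" "Y \<notin> U"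
  shows "(\<lambda>i\<in>I. A i - Y i) \<in> U"
proof -
  let ?B = "product_powerset I A"
  let ?G = "{Z \<in> (\<Pi>\<^sub>E i\<in>I. Pow (A i)). \<exists>W\<in>U. \<forall>i\<in>I. W i \<inter> Y i \<subseteq> Z i}"
  note F = lattice_filter_product_powersetD[OF ultrafilter_product_powersetD(1)[OF U]]
  have G: "lattice_filter ?B ?G"
    using lattice_filter_adjoin[OF ultrafilter_product_powersetD(1)[OF U] Y(1)] .
  have "U \<subseteq> ?G"
    using F(1) by blast
  moreover have "Y \<in> ?G"
    using F(2) Y(1) by blast
  ultimately have "\<not> proper_filter ?B ?G"
    using U Y(2) unfolding ultrafilter_def by blast
  then have "(\<lambda>i\<in>I. {}) \<in> ?G"
    using G proper_filter_product_powerset_iff by blast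
  then obtain W where W: "W \<in> U" "\<forall>i\<in>I. W i \<inter> Y i \<subseteq> {}"
    by auto
  have "W i \<subseteq> (\<lambda>i\<in>I. A i - Y i) i" if "i \<in> I" for i
    using W F(1) that by (fastforce simp: PiE_iff)
  then show ?thesis
    using F(4)[OF W(1), of "\<lambda>i\<in>I. A i - Y i"] by (auto simp: PiE_iff)
qed

section \<open>Filters and ideals of the product ring\<close>

lemma max_support_in_carrier: "max_support I D a \<in> (\<Pi>\<^sub>E i\<in>I. Pow (max_ideals (D i)))"
  by (auto simp: max_support_def max_ideals_containing_def)

text \<open>The element \<open>d\<close> is chosen in each factor separately. Property (+) applies
  in every factor because \<open>a\<close> has no zero coordinate.\<close>

lemma product_property_plus:
  assumes plus: "\<And>i. i \<in> I \<Longrightarrow> property_plus (D i)"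
    and r: "r \<in> carrier (product_ring I D)" and a: "a \<in> carrier (product_ring I D)"
    and nz: "\<And>i. i \<in> I \<Longrightarrow> a i \<noteq> \<zero>\<^bsub>D i\<^esub>"
  obtains d where "d \<in> carrier (product_ring I D)"
    "\<And>i. i \<in> I \<Longrightarrow> max_ideals_containing (D i) (a i) - max_ideals_containing (D i) (r i)
       \<subseteq> max_ideals_containing (D i) (d i)"
    "\<And>i. i \<in> I \<Longrightarrow> max_ideals_containing (D i) (r i) \<inter> max_ideals_containing (D i) (d i) = {}"
proof -
  have "\<exists>d\<in>carrier (D i).
      max_ideals_containing (D i) (a i) - max_ideals_containing (D i) (r i)
        \<subseteq> max_ideals_containing (D i) d \<and>
      max_ideals_containing (D i) (r i) \<inter> max_ideals_containing (D i) d = {}" if i: "i \<in> I" for i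
  proof -
    have "r i \<in> carrier (D i)" "a i \<in> carrier (D i) - {\<zero>\<^bsub>D i\<^esub>}"
      using r a nz i by (auto simp: PiE_iff)
    then obtain d where "d \<in> carrier (D i)"
      "\<forall>M\<in>max_ideals (D i). a i \<in> M \<and> r i \<notin> M \<longrightarrow> d \<in> M"
      "\<forall>M\<in>max_ideals (D i). r i \<in> M \<longrightarrow> d \<notin> M"
      using plus[OF i] unfolding property_plus_def by blast
    then show ?thesis
      by (intro bexI[of _ d]) (auto simp: max_ideals_containing_def)
  qed
  then obtain d where d: "\<forall>i\<in>I. d i \<in> carrier (D i) \<and>
      max_ideals_containing (D i) (a i) - max_ideals_containing (D i) (r i)
        \<subseteq> max_ideals_containing (D i) (d i) \<and>
      max_ideals_containing (D i) (r i) \<inter> max_ideals_containing (D i) (d i) = {}"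
    by metis
  show ?thesis
    \<comment> \<open>The choice function is unspecified outside \<open>I\<close>; restricting it
      makes it an element of the product.\<close>
    by (rule that[of "\<lambda>i\<in>I. d i"]) (use d in auto)
qed

text \<open>Disjointness yields a comaximality equation in each factor. The chosen coefficients
  assemble to elements of the product, which exhibit its identity as a combination of
  \<open>b\<close> and \<open>c\<close>.\<close>

lemma product_disjoint_supports_imp_carrier:
  assumes cring: "\<And>i. i \<in> I \<Longrightarrow> cring (D i)"
    and J: "ideal J (product_ring I D)" and bc: "b \<in> J" "c \<in> J"
    and disj: "\<And>i. i \<in> I \<Longrightarrow>
      max_ideals_containing (D i) (b i) \<inter> max_ideals_containing (D i) (c i) = {}"
  shows "J = carrier (product_ring I D)"
proof -
  interpret J: ideal J "product_ring I D" by fact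
  have carr: "b i \<in> carrier (D i)" "c i \<in> carrier (D i)" if "i \<in> I" for i
    using J.Icarr[OF bc(1)] J.Icarr[OF bc(2)] that by (auto simp: PiE_iff)
  have "\<exists>x y. x \<in> carrier (D i) \<and> y \<in> carrier (D i) \<and>
      x \<otimes>\<^bsub>D i\<^esub> b i \<oplus>\<^bsub>D i\<^esub> y \<otimes>\<^bsub>D i\<^esub> c i = \<one>\<^bsub>D i\<^esub>" if "i \<in> I" for i
    using cring.disjoint_max_ideals_comaximal[OF cring[OF that] carr[OF that] disj[OF that]]
    by metis
  then obtain x y where xy: "\<forall>i\<in>I. x i \<in> carrier (D i) \<and> y i \<in> carrier (D i) \<and>
      x i \<otimes>\<^bsub>D i\<^esub> b i \<oplus>\<^bsub>D i\<^esub> y i \<otimes>\<^bsub>D i\<^esub> c i = \<one>\<^bsub>D i\<^esub>"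
    by metis
  let ?R = "product_ring I D" and ?x = "\<lambda>i\<in>I. x i" and ?y = "\<lambda>i\<in>I. y i"
  have "?x \<in> carrier ?R" "?y \<in> carrier ?R"
    using xy by auto
  then have "?x \<otimes>\<^bsub>?R\<^esub> b \<oplus>\<^bsub>?R\<^esub> ?y \<otimes>\<^bsub>?R\<^esub> c \<in> J"
    using bc by (intro additive_subgroup.a_closed[OF J.additive_subgroup_axioms] J.I_l_closed)
  moreover have "?x \<otimes>\<^bsub>?R\<^esub> b \<oplus>\<^bsub>?R\<^esub> ?y \<otimes>\<^bsub>?R\<^esub> c = \<one>\<^bsub>?R\<^esub>"
    using xy by (auto intro!: restrict_ext)
  ultimately show ?thesis
    using J.one_imp_carrier by metis
qed

text \<open>Filter axioms turn into ideal axioms: zero has the greatest support, the support of a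
  sum lies above the meet of the supports, and multiples have larger support.\<close>

lemma ideal_filter_ideal:
  assumes cring: "\<And>i. i \<in> I \<Longrightarrow> cring (D i)"
    and F: "lattice_filter (max_spec_algebra I D) F"
  shows "ideal (filter_ideal I D F) (product_ring I D)"
proof -
  let ?R = "product_ring I D"
  interpret R: cring ?R
    using product_ring_cring cring .
  note F' = lattice_filter_product_powersetD[OF F[unfolded max_spec_algebra_def]]
  have up: "max_support I D x \<in> F" if "Y \<in> F"
    "\<And>i. i \<in> I \<Longrightarrow> Y i \<subseteq> max_ideals_containing (D i) (x i)" for x Y
    using F'(4)[OF that(1) max_support_in_carrier] that(2) by (simp add: max_support_def)
  have zero: "\<zero>\<^bsub>?R\<^esub> \<in> filter_ideal I D F"
  proof -
    obtain Y where Y: "Y \<in> F"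
      using F'(2) by blast
    then have "Y \<in> (\<Pi>\<^sub>E i\<in>I. Pow (max_ideals (D i)))"
      using F'(1) by blast
    then have "max_support I D \<zero>\<^bsub>?R\<^esub> \<in> F"
      by (intro up[OF Y]) (auto simp: max_ideals_containing_zero PiE_iff)
    then show ?thesis
      using R.zero_closed unfolding filter_ideal_def by blast
  qed
  have add: "b \<oplus>\<^bsub>?R\<^esub> c \<in> filter_ideal I D F"
    if "b \<in> filter_ideal I D F" "c \<in> filter_ideal I D F" for b c
  proof -
    have bc: "b \<in> carrier ?R" "c \<in> carrier ?R" "max_support I D b \<in> F" "max_support I D c \<in> F"
      using that unfolding filter_ideal_def by auto
    have "max_support I D (b \<oplus>\<^bsub>?R\<^esub> c) \<in> F"
      using max_ideals_containing_add
      by (intro up[OF F'(3)[OF bc(3,4)]]) (simp add: max_support_def)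
    then show ?thesis
      using R.a_closed[OF bc(1,2)] unfolding filter_ideal_def by blast
  qed
  have mult: "x \<otimes>\<^bsub>?R\<^esub> b \<in> filter_ideal I D F"
    if "b \<in> filter_ideal I D F" "x \<in> carrier ?R" for b x
  proof -
    have b: "b \<in> carrier ?R" "max_support I D b \<in> F"
      using that unfolding filter_ideal_def by auto
    have "max_support I D (x \<otimes>\<^bsub>?R\<^esub> b) \<in> F"
      using that(2) max_ideals_containing_mult[of "x _" "D _"]
      by (intro up[OF b(2)]) (simp add: max_support_def PiE_iff)
    then show ?thesis
      using R.m_closed[OF that(2) b(1)] unfolding filter_ideal_def by blast
  qed
  have carr: "filter_ideal I D F \<subseteq> carrier ?R"
    unfolding filter_ideal_def by blast
  show ?thesis
  proof (rule idealI[OF R.ring_axioms])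
    show "subgroup (filter_ideal I D F) (add_monoid ?R)"
    proof (rule R.add.subgroupI)
      fix b
      assume b: "b \<in> filter_ideal I D F"
      then have "b \<in> carrier ?R"
        using carr by blast
      \<comment> \<open>Closure under negation is reduced to closure under multiples, with factor
        minus one.\<close>
      then have "\<ominus>\<^bsub>?R\<^esub> b = (\<ominus>\<^bsub>?R\<^esub> \<one>\<^bsub>?R\<^esub>) \<otimes>\<^bsub>?R\<^esub> b"
        using R.l_minus[OF R.one_closed] R.l_one by metis
      then show "\<ominus>\<^bsub>?R\<^esub> b \<in> filter_ideal I D F"
        using mult[OF b R.a_inv_closed[OF R.one_closed]] by metis
    qed (use carr zero add in auto)
    show "x \<otimes>\<^bsub>?R\<^esub> b \<in> filter_ideal I D F" "b \<otimes>\<^bsub>?R\<^esub> x \<in> filter_ideal I D F"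
      if "b \<in> filter_ideal I D F" "x \<in> carrier ?R" for b x
      using mult[OF that] R.m_comm[of b x] that carr by auto
  qed
qed

text \<open>The identity has empty support in every coordinate, and a proper filter omits the least
  element.\<close>

lemma filter_ideal_proper:
  assumes "cring (product_ring I D)" "proper_filter (max_spec_algebra I D) F"
  shows "filter_ideal I D F \<noteq> carrier (product_ring I D)"
proof
  interpret R: cring "product_ring I D" by fact
  assume "filter_ideal I D F = carrier (product_ring I D)"
  then have "\<one>\<^bsub>product_ring I D\<^esub> \<in> filter_ideal I D F"
    using R.one_closed by metis
  then have "max_support I D \<one>\<^bsub>product_ring I D\<^esub> \<in> F"
    unfolding filter_ideal_def by blast
  moreover have "max_support I D \<one>\<^bsub>product_ring I D\<^esub> = (\<lambda>i\<in>I. {})"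
    by (auto simp: max_support_def max_ideals_containing_one intro!: restrict_ext)
  ultimately show False
    using assms(2) by (simp add: max_spec_algebra_def proper_filter_product_powerset_iff)
qed

section \<open>From ultrafilters to maximal ideals\<close>

lemma maximalideal_filter_ideal:
  assumes cring: "\<And>i. i \<in> I \<Longrightarrow> cring (D i)"
    and plus: "\<And>i. i \<in> I \<Longrightarrow> property_plus (D i)"
    and U: "ultrafilter (max_spec_algebra I D) U"
    and a: "a \<in> carrier (product_ring I D)" "\<And>i. i \<in> I \<Longrightarrow> a i \<noteq> \<zero>\<^bsub>D i\<^esub>" "max_support I D a \<in> U"
  shows "maximalideal (filter_ideal I D U) (product_ring I D)"
proof (rule maximalidealI)
  let ?R = "product_ring I D"
  have proper: "proper_filter (max_spec_algebra I D) U"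
    using U unfolding ultrafilter_def by blast
  note U' = U[unfolded max_spec_algebra_def]
  note filt = ultrafilter_product_powersetD(1)[OF U']
  note F = lattice_filter_product_powersetD[OF filt]
  show "ideal (filter_ideal I D U) ?R"
    using ideal_filter_ideal cring filt unfolding max_spec_algebra_def by blast
  show "carrier ?R \<noteq> filter_ideal I D U"
    using filter_ideal_proper[OF product_ring_cring[OF cring] proper] by blast
  fix J
  assume J: "ideal J ?R" "filter_ideal I D U \<subseteq> J" "J \<subseteq> carrier ?R"
  show "J = filter_ideal I D U \<or> J = carrier ?R"
  proof (rule disjCI)
    assume "J \<noteq> carrier ?R"
    show "J = filter_ideal I D U"
    proof (rule ccontr)
      assume "J \<noteq> filter_ideal I D U"
      then obtain r where r: "r \<in> J" "r \<in> carrier ?R" "max_support I D r \<notin> U"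
        using J unfolding filter_ideal_def by blast
      obtain d where d: "d \<in> carrier ?R"
        "\<And>i. i \<in> I \<Longrightarrow> max_ideals_containing (D i) (a i) - max_ideals_containing (D i) (r i)
          \<subseteq> max_ideals_containing (D i) (d i)"
        "\<And>i. i \<in> I \<Longrightarrow>
          max_ideals_containing (D i) (r i) \<inter> max_ideals_containing (D i) (d i) = {}"
        using product_property_plus[OF plus r(2) a(1,2)] by blast
      \<comment> \<open>The support of \<open>d\<close> lies above the meet of S(a) with the
        complement of S(r). Both belong to \<open>U\<close>, the latter because S(r) does
        not.\<close>
      have "max_support I D d \<in> U"
      proof (rule F(4)[OF F(3)[OF a(3) ultrafilter_compl[OF U' max_support_in_carrier r(3)]]
            max_support_in_carrier])
        fix i
        assume "i \<in> I"
        then show "(\<lambda>i\<in>I. max_support I D a i \<inter>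
            (\<lambda>i\<in>I. max_ideals (D i) - max_support I D r i) i) i \<subseteq> max_support I D d i"
          using d(2)[of i] by (auto simp: max_support_def)
      qed
      then have "d \<in> J"
        using d(1) J(2) unfolding filter_ideal_def by blast
      \<comment> \<open>Now \<open>J\<close> contains \<open>r\<close> and \<open>d\<close>, whose
        supports are disjoint.\<close>
      then have "J = carrier ?R"
        using product_disjoint_supports_imp_carrier[OF cring J(1) r(1)] d(3) by blast
      with \<open>J \<noteq> carrier ?R\<close> show False ..
    qed
  qed
qed

section \<open>From maximal ideals to ultrafilters\<close>

text \<open>Since no factor is a field, some \<open>b\<close> has only nonzero nonunit coordinates.
  If \<open>b\<close> is not in \<open>M\<close>, then \<open>M\<close> contains some
  \<open>m\<close> with m + x b = 1, and a zero coordinate of \<open>m\<close> would make that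
  coordinate of \<open>b\<close> a unit.\<close>

lemma max_ideal_contains_nonzero_element:
  assumes dom: "\<And>i. i \<in> I \<Longrightarrow> domain (D i)"
    and nonfield: "\<And>i. i \<in> I \<Longrightarrow> \<not> field (D i)"
    and M: "maximalideal M (product_ring I D)"
  shows "\<exists>a\<in>M. \<forall>i\<in>I. a i \<noteq> \<zero>\<^bsub>D i\<^esub>"
proof -
  let ?R = "product_ring I D"
  have cring: "cring (D i)" if "i \<in> I" for i
    using dom[OF that] by (rule domain.axioms)
  interpret R: cring ?R
    using product_ring_cring cring .
  have "\<exists>b\<in>carrier (D i). b \<noteq> \<zero>\<^bsub>D i\<^esub> \<and> b \<notin> Units (D i)" if "i \<in> I" for i
  proof (rule ccontr)
    interpret domain "D i"
      using dom[OF that] .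
    assume "\<not> ?thesis"
    \<comment> \<open>\<open>cring_fieldI\<close> asks for the exact set of units, so zero has to be
      excluded as well.\<close>
    moreover have "\<zero>\<^bsub>D i\<^esub> \<notin> Units (D i)"
    proof
      assume "\<zero>\<^bsub>D i\<^esub> \<in> Units (D i)"
      from Units_r_inv_ex[OF this] show False
        using zero_not_one by auto
    qed
    ultimately have "Units (D i) = carrier (D i) - {\<zero>\<^bsub>D i\<^esub>}"
      using Units_closed by blast
    then show False
      using cring_fieldI nonfield[OF that] by blast
  qed
  then obtain b where b: "\<forall>i\<in>I. b i \<in> carrier (D i) \<and> b i \<noteq> \<zero>\<^bsub>D i\<^esub> \<and> b i \<notin> Units (D i)"
    by metis
  let ?b = "\<lambda>i\<in>I. b i"
  have bR: "?b \<in> carrier ?R"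
    using b by auto
  show ?thesis
  proof (cases "?b \<in> M")
    case True
    then show ?thesis
      using b by (intro bexI[of _ ?b]) auto
  next
    case False
    then obtain m x where mx: "m \<in> M" "x \<in> carrier ?R" "m \<oplus>\<^bsub>?R\<^esub> x \<otimes>\<^bsub>?R\<^esub> ?b = \<one>\<^bsub>?R\<^esub>"
      using R.maximalideal_comaximal[OF M bR] by blast
    have "m i \<noteq> \<zero>\<^bsub>D i\<^esub>" if i: "i \<in> I" for i
    proof
      interpret domain "D i"
        using dom[OF i] .
      assume "m i = \<zero>\<^bsub>D i\<^esub>"
      moreover have "m i \<oplus>\<^bsub>D i\<^esub> x i \<otimes>\<^bsub>D i\<^esub> b i = \<one>\<^bsub>D i\<^esub>"
        using fun_cong[OF mx(3), of i] i by simp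
      moreover have "x i \<in> carrier (D i)" "b i \<in> carrier (D i)"
        using mx(2) b i by (auto simp: PiE_iff)
      ultimately have "b i \<in> Units (D i)"
        using m_comm unfolding Units_def by force
      then show False
        using b i by blast
    qed
    then show ?thesis
      using mx(1) by blast
  qed
qed

text \<open>This is the filter generated by the meets of S(a) with S(b), for \<open>b\<close> in
  \<open>M\<close>. The meet with S(a) is built in because property (+) controls the support of a
  combination only inside S(a).\<close>

lemma proper_filter_of_ideal:
  assumes cring: "\<And>i. i \<in> I \<Longrightarrow> cring (D i)"
    and plus: "\<And>i. i \<in> I \<Longrightarrow> property_plus (D i)"
    and M: "ideal M (product_ring I D)" "M \<noteq> carrier (product_ring I D)"
    and a: "a \<in> M" "\<And>i. i \<in> I \<Longrightarrow> a i \<noteq> \<zero>\<^bsub>D i\<^esub>"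
  shows "proper_filter (max_spec_algebra I D)
    {Y \<in> (\<Pi>\<^sub>E i\<in>I. Pow (max_ideals (D i))). \<exists>b\<in>M. \<forall>i\<in>I.
       max_ideals_containing (D i) (a i) \<inter> max_ideals_containing (D i) (b i) \<subseteq> Y i}"
    (is "proper_filter _ ?F")
proof -
  let ?R = "product_ring I D"
  interpret M: ideal M ?R by fact
  have "lattice_filter (product_powerset I (\<lambda>i. max_ideals (D i))) ?F"
  proof (rule lattice_filter_product_powersetI)
    show "?F \<subseteq> (\<Pi>\<^sub>E i\<in>I. Pow (max_ideals (D i)))"
      by blast
    \<comment> \<open>The witness \<open>b\<close> is \<open>a\<close> itself.\<close>
    have "max_support I D a \<in> ?F"
      using max_support_in_carrier[of I D a] a(1) by (auto simp: max_support_def)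
    then show "?F \<noteq> {}"
      by blast
    fix Y Z
    assume Y: "Y \<in> ?F"
    {
      assume Z: "Z \<in> ?F"
      from Y obtain b where b: "b \<in> M" "\<forall>i\<in>I.
          max_ideals_containing (D i) (a i) \<inter> max_ideals_containing (D i) (b i) \<subseteq> Y i"
        by blast
      from Z obtain c where c: "c \<in> M" "\<forall>i\<in>I.
          max_ideals_containing (D i) (a i) \<inter> max_ideals_containing (D i) (c i) \<subseteq> Z i"
        by blast
      obtain d where d: "d \<in> carrier ?R"
        "\<And>i. i \<in> I \<Longrightarrow> max_ideals_containing (D i) (a i) - max_ideals_containing (D i) (b i)
          \<subseteq> max_ideals_containing (D i) (d i)"
        "\<And>i. i \<in> I \<Longrightarrow>
          max_ideals_containing (D i) (b i) \<inter> max_ideals_containing (D i) (d i) = {}"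
        using product_property_plus[OF plus M.Icarr[OF b(1)] M.Icarr[OF a(1)] a(2)] by blast
      \<comment> \<open>This single element of \<open>M\<close> witnesses the meet of
        \<open>Y\<close> and \<open>Z\<close>: inside S(a), its support lies below those of both
        \<open>b\<close> and \<open>c\<close>.\<close>
      let ?e = "b \<oplus>\<^bsub>?R\<^esub> d \<otimes>\<^bsub>?R\<^esub> c"
      have "?e \<in> M"
        using b(1) c(1) d(1) by (intro additive_subgroup.a_closed[OF M.additive_subgroup_axioms] M.I_l_closed)
      moreover have "max_ideals_containing (D i) (a i) \<inter> max_ideals_containing (D i) (?e i)
          \<subseteq> (\<lambda>i\<in>I. Y i \<inter> Z i) i" if i: "i \<in> I" for i
      proof -
        have "b i \<in> carrier (D i)" "c i \<in> carrier (D i)" "d i \<in> carrier (D i)"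
          using M.Icarr[OF b(1)] M.Icarr[OF c(1)] d(1) i by (auto simp: PiE_iff)
        from cring.max_ideals_containing_combination[OF cring[OF i] this d(2,3)[OF i]]
        show ?thesis
          using bspec[OF b(2) i] bspec[OF c(2) i] i by auto
      qed
      moreover have "(\<lambda>i\<in>I. Y i \<inter> Z i) \<in> (\<Pi>\<^sub>E i\<in>I. Pow (max_ideals (D i)))"
        using Y by (auto simp: PiE_iff)
      ultimately show "(\<lambda>i\<in>I. Y i \<inter> Z i) \<in> ?F"
        by blast
    next
      assume "Z \<in> (\<Pi>\<^sub>E i\<in>I. Pow (max_ideals (D i)))" "\<And>i. i \<in> I \<Longrightarrow> Y i \<subseteq> Z i"
      then show "Z \<in> ?F"
        using Y by (blast intro: subset_trans)
    }
  qed
  moreover have "(\<lambda>i\<in>I. {}) \<notin> ?F"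
  proof
    \<comment> \<open>Then \<open>a\<close> and some \<open>b\<close>, both in \<open>M\<close>,
      have disjoint supports, so \<open>M\<close> would be the whole ring.\<close>
    assume "(\<lambda>i\<in>I. {}) \<in> ?F"
    then obtain b where "b \<in> M" "\<forall>i\<in>I.
        max_ideals_containing (D i) (a i) \<inter> max_ideals_containing (D i) (b i) = {}"
      by auto
    then show False
      using product_disjoint_supports_imp_carrier[OF cring M(1) a(1)] M(2) by blast
  qed
  ultimately show ?thesis
    by (simp add: max_spec_algebra_def proper_filter_product_powerset_iff)
qed

text \<open>Only the inclusion of \<open>M\<close> in the ideal of \<open>U\<close> is checked by
  elements. That ideal is proper, so maximality of \<open>M\<close> turns the inclusion into
  equality.\<close>

lemma max_ideal_eq_filter_ideal:
  assumes cring: "\<And>i. i \<in> I \<Longrightarrow> cring (D i)"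
    and plus: "\<And>i. i \<in> I \<Longrightarrow> property_plus (D i)"
    and M: "maximalideal M (product_ring I D)"
    and a: "a \<in> M" "\<And>i. i \<in> I \<Longrightarrow> a i \<noteq> \<zero>\<^bsub>D i\<^esub>"
  shows "\<exists>U. ultrafilter (max_spec_algebra I D) U \<and> max_support I D a \<in> U \<and>
    M = filter_ideal I D U"
proof -
  let ?R = "product_ring I D"
  interpret M: maximalideal M ?R by fact
  let ?F = "{Y \<in> (\<Pi>\<^sub>E i\<in>I. Pow (max_ideals (D i))). \<exists>b\<in>M. \<forall>i\<in>I.
       max_ideals_containing (D i) (a i) \<inter> max_ideals_containing (D i) (b i) \<subseteq> Y i}"
  have "proper_filter (max_spec_algebra I D) ?F"
    using proper_filter_of_ideal[OF cring plus M.ideal_axioms M.I_notcarr[symmetric] a] by blast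
  then obtain U where U: "ultrafilter (max_spec_algebra I D) U" and sub: "?F \<subseteq> U"
    using exists_ultrafilter_above unfolding max_spec_algebra_def by blast
  \<comment> \<open>The support of \<open>b\<close> lies above its meet with S(a), which generates
    \<open>?F\<close>. The case of \<open>a\<close> itself later gives the required member of
    \<open>U\<close>.\<close>
  have S: "max_support I D b \<in> U" if "b \<in> M" for b
  proof -
    have "max_support I D b \<in> ?F"
      using max_support_in_carrier[of I D b] that by (auto simp: max_support_def)
    then show ?thesis
      using sub by blast
  qed
  have proper: "proper_filter (max_spec_algebra I D) U"
    using U unfolding ultrafilter_def by blast
  then have J: "ideal (filter_ideal I D U) ?R"
    using ideal_filter_ideal cring unfolding proper_filter_def by blast
  have "M \<subseteq> filter_ideal I D U"
    using S M.Icarr unfolding filter_ideal_def by blast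
  moreover have "filter_ideal I D U \<subseteq> carrier ?R"
    unfolding filter_ideal_def by blast
  ultimately have "filter_ideal I D U = M"
    using M.I_maximal[OF J] filter_ideal_proper[OF product_ring_cring[OF cring] proper] by blast
  then show ?thesis
    using U S[OF a(1)] by blast
qed

theorem corollary2p14:
  fixes \<Lambda> :: "'i set" and D :: "'i \<Rightarrow> ('a, 'm) ring_scheme"
  assumes "\<And>l. l \<in> \<Lambda> \<Longrightarrow> domain (D l)"
    and "\<And>l. l \<in> \<Lambda> \<Longrightarrow> property_plus (D l)"
    and "\<And>l. l \<in> \<Lambda> \<Longrightarrow> \<not> field (D l)"
  shows "max_ideals (product_ring \<Lambda> D) =
    {filter_ideal \<Lambda> D U | U. ultrafilter (max_spec_algebra \<Lambda> D) U \<and>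
       (\<exists>a\<in>carrier (product_ring \<Lambda> D). (\<forall>l\<in>\<Lambda>. a l \<noteq> \<zero>\<^bsub>D l\<^esub>) \<and> max_support \<Lambda> D a \<in> U)}"
    (is "_ = ?rhs")
proof (intro equalityI subsetI)
  have cring: "cring (D l)" if "l \<in> \<Lambda>" for l
    using assms(1)[OF that] by (rule domain.axioms)
  fix M
  {
    assume "M \<in> max_ideals (product_ring \<Lambda> D)"
    then have M: "maximalideal M (product_ring \<Lambda> D)"
      by (simp add: max_ideals_def)
    interpret M: maximalideal M "product_ring \<Lambda> D" by fact
    \<comment> \<open>This \<open>a\<close> serves twice: the ultrafilter is built around its
      support, and it is the witness demanded on the right-hand side.\<close>
    obtain a where a: "a \<in> M" "\<And>l. l \<in> \<Lambda> \<Longrightarrow> a l \<noteq> \<zero>\<^bsub>D l\<^esub>"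
      using max_ideal_contains_nonzero_element[OF assms(1,3) M] by blast
    moreover obtain U where "ultrafilter (max_spec_algebra \<Lambda> D) U" "max_support \<Lambda> D a \<in> U"
      "M = filter_ideal \<Lambda> D U"
      using max_ideal_eq_filter_ideal[OF cring assms(2) M a] by blast
    ultimately show "M \<in> ?rhs"
      using M.Icarr[OF a(1)] by blast
  next
    assume "M \<in> ?rhs"
    then obtain U a where U: "ultrafilter (max_spec_algebra \<Lambda> D) U"
      and a: "a \<in> carrier (product_ring \<Lambda> D)" "\<And>l. l \<in> \<Lambda> \<Longrightarrow> a l \<noteq> \<zero>\<^bsub>D l\<^esub>" "max_support \<Lambda> D a \<in> U"
      and M: "M = filter_ideal \<Lambda> D U"
      by blast
    have "maximalideal (filter_ideal \<Lambda> D U) (product_ring \<Lambda> D)"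
      by (rule maximalideal_filter_ideal[OF cring assms(2) U a])
    then show "M \<in> max_ideals (product_ring \<Lambda> D)"
      by (simp add: max_ideals_def M)
  }
qed

end
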